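(* Let $\mu,\nu$ be probability measures on $\mathbb{R}$ with $\mu\preceq_C\nu$ (convex order), and let $\pi_{\mathrm{lc}}$ be the left-curtain coupling of $\mu$ and $\nu$. For every real number $t$, the measure $\nu_t^{\pi_{\mathrm{lc}}}$ is minimal with respect to the convex order in the family $\{\nu_t^{\pi}:\pi\in\Pi_M(\mu,\nu)\}$; that is, $\nu_t^{\pi_{\mathrm{lc}}}\preceq_C\nu_t^{\pi}$ for every $\pi\in\Pi_M(\mu,\nu)$.
   Context: Convex order: two finite Borel measures $\mu,\nu$ on $\mathbb{R}$ with finite first moments satisfy $\mu\preceq_C\nu$ if $\int\varphi\,d\mu\le\int\varphi\,d\nu$ for every convex $\varphi:\mathbb{R}\to\mathbb{R}$. $\Pi_M(\mu,\nu)$ (martingale transport plans) is the set of Borel measures $\pi$ on $\mathbb{R}\times\mathbb{R}$ with first marginal $\mu$, second marginal $\nu$, whose disintegration $(\pi_x)_{x\in\mathbb{R}}$ into probability measures with respect to $\mu$ satisfies $\int y\,d\pi_x(y)=x$ for $\mu$-a.e. $x$. For $\pi\in\Pi_M(\mu,\nu)$ and $t\in\mathbb{R}$, $\nu_t^\pi:=\mathrm{proj}^y_\#\big(\pi|_{]-\infty,t]\times\mathbb{R}}\big)$ is the second marginal of the restriction of $\pi$ to $]-\infty,t]\times\mathbb{R}$. A martingale transport plan $\pi$ is left-monotone if there is a Borel set $\Gamma\subseteq\mathbb{R}\times\mathbb{R}$ with $\pi(\Gamma)=1$ such that whenever $(x,y^-),(x,y^+),(x',y')\in\Gamma$, one cannot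 have both $x<x'$ and $y^-<y'<y^+$. The left-curtain coupling $\pi_{\mathrm{lc}}$ is the unique left-monotone element of $\Pi_M(\mu,\nu)$ (it exists and is unique whenever $\mu\preceq_C\nu$). *)

theory Defs
  imports "HOL-Probability.Probability"
begin

definition finite_first_moment :: "real measure \<Rightarrow> bool" where
  "finite_first_moment \<mu> \<longleftrightarrow>
     sets \<mu> = sets borel \<and> finite_measure \<mu> \<and> integrable \<mu> (\<lambda>x. x)"

(* The integral of a convex function may be +infinity, where the Bochner integral
   would return 0.  The negative part of a convex function is integrable with respect
   to a finite measure with finite first moment (there is an affine minorant), so
   infinity - infinity does not occur below. *)
definition ext_integral :: "real measure \<Rightarrow> (real \<Rightarrow> real) \<Rightarrow> ereal" where
  "ext_integral \<mu> \<phi> =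
     enn2ereal (\<integral>\<^sup>+ x. ennreal (\<phi> x) \<partial>\<mu>) - enn2ereal (\<integral>\<^sup>+ x. ennreal (- \<phi> x) \<partial>\<mu>)"

definition convex_order :: "real measure \<Rightarrow> real measure \<Rightarrow> bool"  (infix "\<preceq>\<^sub>C" 50) where
  "\<mu> \<preceq>\<^sub>C \<nu> \<longleftrightarrow> finite_first_moment \<mu> \<and> finite_first_moment \<nu> \<and>
     (\<forall>\<phi>. convex_on UNIV \<phi> \<longrightarrow> ext_integral \<mu> \<phi> \<le> ext_integral \<nu> \<phi>)"

definition disintegration ::
    "(real \<times> real) measure \<Rightarrow> real measure \<Rightarrow> (real \<Rightarrow> real measure) \<Rightarrow> bool" where
  "disintegration \<pi> \<mu> \<kappa> \<longleftrightarrow> \<kappa> \<in> borel \<rightarrow>\<^sub>M prob_algebra borel \<and>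
     (\<forall>A\<in>sets borel. \<forall>B\<in>sets borel.
        emeasure \<pi> (A \<times> B) = (\<integral>\<^sup>+ x\<in>A. emeasure (\<kappa> x) B \<partial>\<mu>))"

(* Disintegrations are unique up to null sets of the first marginal, so the existential
   quantifier over kernels expresses a property of the disintegration of the plan. *)
definition martingale_plans :: "real measure \<Rightarrow> real measure \<Rightarrow> (real \<times> real) measure set"
    ("\<Pi>\<^sub>M") where
  "\<Pi>\<^sub>M \<mu> \<nu> = {\<pi>. sets \<pi> = sets borel \<and> distr \<pi> borel fst = \<mu> \<and> distr \<pi> borel snd = \<nu> \<and>
     (\<exists>\<kappa>. disintegration \<pi> \<mu> \<kappa> \<and>
        (AE x in \<mu>. integrable (\<kappa> x) (\<lambda>y. y) \<and> (\<integral>y. y \<partial>(\<kappa> x)) = x))}"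

definition snd_marginal_upto :: "(real \<times> real) measure \<Rightarrow> real \<Rightarrow> real measure" where
  "snd_marginal_upto \<pi> t = distr (restrict_space \<pi> ({..t} \<times> UNIV)) borel snd"

definition left_monotone :: "(real \<times> real) measure \<Rightarrow> bool" where
  "left_monotone \<pi> \<longleftrightarrow> (\<exists>\<Gamma>\<in>sets borel. emeasure \<pi> \<Gamma> = 1 \<and>
     (\<forall>x ym yp x' y'. (x, ym) \<in> \<Gamma> \<and> (x, yp) \<in> \<Gamma> \<and> (x', y') \<in> \<Gamma> \<longrightarrow>
        \<not> (x < x' \<and> ym < y' \<and> y' < yp)))"

(* There is exactly one such plan whenever the marginals are in convex order; neither
   existence nor uniqueness is built into this predicate. *)
definition left_curtain_coupling ::
    "real measure \<Rightarrow> real measure \<Rightarrow> (real \<times> real) measure \<Rightarrow> bool" where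
  "left_curtain_coupling \<mu> \<nu> \<pi> \<longleftrightarrow> \<pi> \<in> \<Pi>\<^sub>M \<mu> \<nu> \<and> left_monotone \<pi>"

end

(* Write U for the union, over x <= t, of the open convex hulls of the fibres of the monotone
   set Gamma.  No mass starting to the right of t may land in U, so the left-curtain plan moves
   all of the mass of nu in U from (-infinity, t]; any other plan moves at most that much there.
   A strike p outside U is not straddled by any fibre over x <= t, so for the left-curtain plan the
   integral of (y - p)^+ equals that of (x - p)^+ over x <= t, which by Jensen's inequality is
   the least value possible.  For a strike k in U, replacing (y - k)^+ on the component of U
   containing k by its chord gives a convex f which is a combination of calls with strikes
   outside U, and f - (y - k)^+ is nonnegative and vanishes outside U; subtracting the two
   comparisons gives the claim for (y - k)^+.  Calls determine the convex order. *)
theory Submission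
  imports Defs
begin

section \<open>Convex order and calls\<close>

text \<open>A term with \<open>c i > 0\<close> is \<open>c i\<close> times the call with strike
  \<open>- d i / c i\<close>. Storing slope and offset instead of a strike also admits
  \<open>c i = 0\<close>, which occurs when consecutive tangents have equal slopes.\<close>

definition call_combination :: "(real \<Rightarrow> real) \<Rightarrow> bool" where
  "call_combination F \<longleftrightarrow> (\<exists>a b m c d. (\<forall>i. 0 \<le> c i) \<and>
     F = (\<lambda>y. a + b * y + (\<Sum>i<m::nat. max 0 (c i * y + d i))))"

text \<open>For tangents \<open>l\<^sub>0, \<dots>, l\<^sub>m\<close> at increasing points, \<open>l\<^sub>0 + (\<Sum>i<m. max 0 (l\<^sub>i\<^sub>+\<^sub>1 - l\<^sub>i))\<close> is their maximum.\<close>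

lemma convex_approx_by_calls:
  fixes \<phi> :: "real \<Rightarrow> real"
  assumes "convex_on UNIV \<phi>"
  shows "\<exists>\<Phi> \<alpha> \<beta>. (\<forall>n. call_combination (\<Phi> n) \<and> (\<forall>y. \<alpha> + \<beta> * y \<le> \<Phi> n y \<and> \<Phi> n y \<le> \<phi> y)) \<and>
    (\<forall>y. (\<lambda>n. \<Phi> n y) \<longlonglongrightarrow> \<phi> y)"
proof -
  obtain s where s: "\<And>p y. \<phi> p + s p * (y - p) \<le> \<phi> y"
  proof -
    have "\<forall>p. \<exists>s. \<forall>y. \<phi> p + s * (y - p) \<le> \<phi> y"
      using convex_le_Inf_differential[OF assms] by (metis UNIV_I interior_UNIV)
    then show thesis using that by metis
  qed
  define l where "l = (\<lambda>p y. \<phi> p + s p * (y - p))"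
  have l_le: "l p y \<le> \<phi> y" for p y using s by (simp add: l_def)
  have s_mono: "s p \<le> s q" if "p \<le> q" for p q
  proof (cases "p = q")
    case False
    have "(q - p) * s p \<le> (q - p) * s q" using s[of p q] s[of q p] by (simp add: algebra_simps)
    then show ?thesis using that False by simp
  qed simp
  \<comment> \<open>\<open>s[of q p]\<close> puts \<open>l q\<close> below \<open>l p\<close> at the
    point \<open>p\<close>, and \<open>l q\<close> is at least as steep, so it stays below to the
    left of \<open>p\<close>. The next fact is the mirror image.\<close>
  have l_left: "l q y \<le> l p y" if "y \<le> p" "p \<le> q" for p q y
  proof -
    have "s p * (p - y) \<le> s q * (p - y)" using that s_mono by (intro mult_right_mono) auto
    then show ?thesis using s[of q p] by (simp add: l_def algebra_simps)
  qed
  have l_right: "l p y \<le> l q y" if "q \<le> y" "p \<le> q" for p q y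
  proof -
    have "s p * (y - q) \<le> s q * (y - q)" using that s_mono by (intro mult_right_mono) auto
    then show ?thesis using s[of p q] by (simp add: l_def algebra_simps)
  qed
  \<comment> \<open>The grid has mesh \<open>1 / 2 ^ n\<close> and starts at \<open>- n\<close>; the
    \<open>2 * n * 2 ^ n\<close> steps fixed below as \<open>m n\<close> take it to
    \<open>n\<close>. It always contains 0, and it exhausts the line as \<open>n\<close>
    grows.\<close>
  define g where "g = (\<lambda>(n::nat) (i::nat). - real n + real i / 2 ^ n)"
  have g_mono: "g n i \<le> g n (Suc i)" for n i by (simp add: g_def divide_right_mono)
  define \<Psi> where "\<Psi> = (\<lambda>n k y. l (g n 0) y + (\<Sum>i<k. max 0 (l (g n (Suc i)) y - l (g n i) y)))"
  \<comment> \<open>The second conjunct carries the induction: while the grid points lie left of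
    \<open>y\<close>, the increments are nonnegative and the sum telescopes to the last tangent. The
    step across \<open>y\<close> takes the larger of two tangents, and beyond \<open>y\<close> the
    increments are nonpositive and are cut to 0.\<close>
  have \<Psi>_ub: "\<Psi> n k y \<le> \<phi> y \<and> (g n k \<le> y \<longrightarrow> \<Psi> n k y = l (g n k) y)" for n k y
  proof (induction k)
    case 0 then show ?case by (simp add: \<Psi>_def l_le)
  next
    case (Suc k)
    have \<Psi>_Suc: "\<Psi> n (Suc k) y = \<Psi> n k y + max 0 (l (g n (Suc k)) y - l (g n k) y)"
      by (simp add: \<Psi>_def)
    show ?case
    proof (cases "g n k \<le> y")
      case True
      then show ?thesis using Suc \<Psi>_Suc l_le[of "g n (Suc k)" y] l_right[OF _ g_mono[of n k], of y] by auto
    next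
      case False
      then show ?thesis using Suc \<Psi>_Suc l_left[OF _ g_mono[of n k], of y] g_mono[of n k] by auto
    qed
  qed
  have tele: "l (g n i) y \<le> \<Psi> n i y" for n i y
  proof -
    have "l (g n i) y - l (g n 0) y = (\<Sum>j<i. l (g n (Suc j)) y - l (g n j) y)"
      by (rule sum_lessThan_telescope[symmetric])
    also have "\<dots> \<le> (\<Sum>j<i. max 0 (l (g n (Suc j)) y - l (g n j) y))" by (intro sum_mono) auto
    finally show ?thesis by (simp add: \<Psi>_def)
  qed
  have \<Psi>_mono: "\<Psi> n i y \<le> \<Psi> n k y" if "i \<le> k" for n i k y
    unfolding \<Psi>_def using that by (intro add_left_mono sum_mono2) auto
  define m where "m = (\<lambda>n::nat. 2 * n * 2 ^ n)"
  define \<Phi> where "\<Phi> = (\<lambda>n. \<Psi> n (m n))"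
  have lb: "l (g n i) y \<le> \<Phi> n y" if "i \<le> m n" for n i y
    using tele \<Psi>_mono[OF that] unfolding \<Phi>_def by (rule order_trans)
  show ?thesis
  proof (intro exI conjI allI)
    show "call_combination (\<Phi> n)" for n
      unfolding call_combination_def
    proof (intro exI conjI allI)
      show "0 \<le> s (g n (Suc i)) - s (g n i)" for i using s_mono[OF g_mono[of n i]] by simp
      show "\<Phi> n = (\<lambda>y. (\<phi> (g n 0) - s (g n 0) * g n 0) + s (g n 0) * y +
        (\<Sum>i<m n. max 0 ((s (g n (Suc i)) - s (g n i)) * y +
         ((\<phi> (g n (Suc i)) - s (g n (Suc i)) * g n (Suc i)) - (\<phi> (g n i) - s (g n i) * g n i)))))"
        unfolding \<Phi>_def \<Psi>_def l_def by (simp add: algebra_simps)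
    qed
    show "\<Phi> n y \<le> \<phi> y" for n y using \<Psi>_ub by (simp add: \<Phi>_def)
    \<comment> \<open>Every grid contains 0, so the tangent at 0 is one affine minorant for all
      \<open>n\<close>.\<close>
    show "\<phi> 0 + s 0 * y \<le> \<Phi> n y" for n y
    proof -
      have "g n (n * 2 ^ n) = 0" by (simp add: g_def)
      then show ?thesis using lb[of "n * 2 ^ n" n y] by (simp add: m_def l_def)
    qed
    show "(\<lambda>n. \<Phi> n y) \<longlonglongrightarrow> \<phi> y" for y
    proof (rule tendsto_sandwich)
      \<comment> \<open>\<open>q n\<close> is the last dyadic point of level \<open>n\<close> not
        beyond \<open>y\<close>. The tangent there bounds \<open>\<Phi> n y\<close> from below; its
        slope is replaced by the fixed \<open>s (y - 1)\<close>, which is no larger since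
        \<open>y - 1 \<le> q n\<close>, so that the limit needs no control of
        \<open>s (q n)\<close>.\<close>
      define q where "q = (\<lambda>n::nat. real_of_int \<lfloor>y * 2 ^ n\<rfloor> / 2 ^ n)"
      have q_le: "q n \<le> y" for n by (simp add: q_def divide_le_eq)
      have q_ge: "y - q n \<le> (1/2) ^ n" for n
      proof -
        have "y * 2 ^ n - real_of_int \<lfloor>y * 2 ^ n\<rfloor> \<le> 1" by linarith
        then have "(y * 2 ^ n - real_of_int \<lfloor>y * 2 ^ n\<rfloor>) / 2 ^ n \<le> 1 / 2 ^ n" by (intro divide_right_mono) auto
        then show ?thesis by (simp add: q_def diff_divide_distrib power_one_over)
      qed
      have half: "(\<lambda>n. (1/2) ^ n :: real) \<longlonglongrightarrow> 0" by (intro LIMSEQ_power_zero) auto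
      have yq: "(\<lambda>n. y - q n) \<longlonglongrightarrow> 0"
        by (rule tendsto_sandwich[OF _ _ tendsto_const half]) (use q_le q_ge in auto)
      have "(\<lambda>n. y - (y - q n)) \<longlonglongrightarrow> y - 0" by (intro tendsto_intros yq)
      then have q: "q \<longlonglongrightarrow> y" by simp
      have "continuous_on UNIV \<phi>" by (rule convex_on_continuous[OF open_UNIV assms])
      then have "isCont \<phi> y" by (simp add: continuous_on_eq_continuous_at)
      then have "(\<lambda>n. \<phi> (q n)) \<longlonglongrightarrow> \<phi> y" using q by (rule isCont_tendsto_compose)
      then have "(\<lambda>n. \<phi> (q n) + s (y - 1) * (y - q n)) \<longlonglongrightarrow> \<phi> y + s (y - 1) * 0"
        by (intro tendsto_intros yq)
      then show "(\<lambda>n. \<phi> (q n) + s (y - 1) * (y - q n)) \<longlonglongrightarrow> \<phi> y" by simp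
      \<comment> \<open>From \<open>N\<close> on, \<open>y\<close> lies between \<open>- n\<close>
        and \<open>n\<close>, so \<open>q n\<close> is one of the grid points \<open>g n i\<close>
        with \<open>i \<le> m n\<close>.\<close>
      obtain N :: nat where N: "\<bar>y\<bar> + 1 \<le> real N" using real_arch_simple by blast
      show "\<forall>\<^sub>F n in sequentially. \<phi> (q n) + s (y - 1) * (y - q n) \<le> \<Phi> n y"
        unfolding eventually_sequentially
      proof (intro exI[of _ N] allI impI)
        fix n assume "N \<le> n"
        then have n: "\<bar>y\<bar> + 1 \<le> real n" using N by linarith
        have p1: "(1/2 :: real) ^ n \<le> 1" by (intro power_le_one) auto
        let ?i = "nat (\<lfloor>y * 2 ^ n\<rfloor> + int n * 2 ^ n)"
        have "(- real n) * 2 ^ n \<le> y * 2 ^ n" "y * 2 ^ n \<le> real n * 2 ^ n"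
          using n by (intro mult_right_mono; simp)+
        then have "real_of_int (- (int n * 2 ^ n)) \<le> y * 2 ^ n"
          and "real_of_int \<lfloor>y * 2 ^ n\<rfloor> \<le> real_of_int (int n * 2 ^ n)"
          using of_int_floor_le[of "y * 2 ^ n"] by (simp_all only: of_int_minus of_int_mult of_int_of_nat_eq of_int_power of_int_numeral)
        then have "- (int n * 2 ^ n) \<le> \<lfloor>y * 2 ^ n\<rfloor>" "\<lfloor>y * 2 ^ n\<rfloor> \<le> int n * 2 ^ n"
          by (simp_all only: le_floor_iff of_int_le_iff)
        then have i0: "0 \<le> \<lfloor>y * 2 ^ n\<rfloor> + int n * 2 ^ n" and "\<lfloor>y * 2 ^ n\<rfloor> + int n * 2 ^ n \<le> int (m n)"
          by (auto simp: m_def)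
        then have i: "?i \<le> m n" by linarith
        have "real ?i = real_of_int \<lfloor>y * 2 ^ n\<rfloor> + real n * 2 ^ n" using i0 by (simp add: of_nat_nat)
        then have gi: "g n ?i = q n" by (simp add: g_def q_def add_divide_distrib)
        have "y - 1 \<le> q n" using q_ge[of n] p1 by linarith
        then have "s (y - 1) * (y - q n) \<le> s (q n) * (y - q n)" using s_mono q_le by (intro mult_right_mono) auto
        then show "\<phi> (q n) + s (y - 1) * (y - q n) \<le> \<Phi> n y"
          using lb[OF i, of y] unfolding gi by (simp add: l_def)
      qed
      show "\<forall>\<^sub>F n in sequentially. \<Phi> n y \<le> \<phi> y" using \<Psi>_ub by (simp add: \<Phi>_def)
      show "(\<lambda>_. \<phi> y) \<longlonglongrightarrow> \<phi> y" by simp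
    qed
  qed
qed

section \<open>Calls determine the convex order\<close>

lemma integrable_call:
  assumes "finite_first_moment M"
  shows "integrable M (\<lambda>y. max 0 (c * y + d))"
proof -
  interpret finite_measure M using assms by (simp add: finite_first_moment_def)
  have "integrable M (\<lambda>y. y)" using assms by (simp add: finite_first_moment_def)
  then show ?thesis by (intro integrable_max) auto
qed

text \<open>Equal masses and means settle the affine part of a \<open>call_combination\<close>, the
  calls settle the rest. A general convex \<open>\<phi>\<close> is reached from below: Fatou's lemma
  passes to the limit under \<open>M\<close>, and under \<open>N\<close> the bound
  \<open>\<Phi> n y \<le> \<phi> y\<close> is enough.\<close>

lemma convex_order_if_calls:
  assumes M: "finite_first_moment M" and N: "finite_first_moment N"
    and mass: "measure M UNIV = measure N UNIV"
    and mean: "(\<integral>y. y \<partial>M) = (\<integral>y. y \<partial>N)"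
    and calls: "\<And>k. (\<integral>y. max 0 (y - k) \<partial>M) \<le> (\<integral>y. max 0 (y - k) \<partial>N)"
  shows "M \<preceq>\<^sub>C N"
  unfolding convex_order_def
proof (intro conjI allI impI M N)
  fix \<phi> :: "real \<Rightarrow> real" assume cvx: "convex_on UNIV \<phi>"
  interpret M: finite_measure M using M by (simp add: finite_first_moment_def)
  interpret N: finite_measure N using N by (simp add: finite_first_moment_def)
  have [measurable_cong]: "sets M = sets borel" "sets N = sets borel"
    using M N by (auto simp: finite_first_moment_def)
  have sp: "space M = UNIV" "space N = UNIV"
    using M N by (auto simp: finite_first_moment_def dest: sets_eq_imp_space_eq)
  have id [simp]: "integrable M (\<lambda>y. y)" "integrable N (\<lambda>y. y)" using M N by (auto simp: finite_first_moment_def)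
  have [measurable]: "\<phi> \<in> borel_measurable borel"
    by (rule borel_measurable_continuous_onI) (rule convex_on_continuous[OF open_UNIV cvx])
  obtain \<Phi> \<alpha> \<beta> where approx: "(\<forall>n. call_combination (\<Phi> n) \<and> (\<forall>y. \<alpha> + \<beta> * y \<le> \<Phi> n y \<and> \<Phi> n y \<le> \<phi> y)) \<and>
    (\<forall>y. (\<lambda>n. \<Phi> n y) \<longlonglongrightarrow> \<phi> y)"
    using convex_approx_by_calls[OF cvx] by (elim exE) (rule that)
  then have \<Phi>: "call_combination (\<Phi> n)" and ub: "\<Phi> n y \<le> \<phi> y" and lb: "\<alpha> + \<beta> * y \<le> \<Phi> n y"
    and lim: "(\<lambda>n. \<Phi> n y) \<longlonglongrightarrow> \<phi> y" for n y
    by simp_all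
  have mass': "(\<integral>y. r \<partial>M) = (\<integral>y. r \<partial>N)" for r :: real using mass sp by simp
  have call': "(\<integral>y. max 0 (p * y + r) \<partial>M) \<le> (\<integral>y. max 0 (p * y + r) \<partial>N)" if "0 \<le> p" for p r
  proof (cases "p = 0")
    case False
    then have "max 0 (p * y + r) = p * max 0 (y - (- r / p))" for y
      using that by (simp add: max_def field_simps)
    then show ?thesis using calls[of "- r / p"] that by (simp add: mult_left_mono)
  qed (use mass sp in simp)
  have comb: "integrable M F \<and> integrable N F \<and> F \<in> borel_measurable borel \<and> integral\<^sup>L M F \<le> integral\<^sup>L N F"
    if F: "call_combination F" for F
  proof -
    obtain a b m c d where c: "\<And>i. 0 \<le> c i"
      and F: "F = (\<lambda>y. a + b * y + (\<Sum>i<m::nat. max 0 (c i * y + d i)))"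
      using F unfolding call_combination_def by blast
    note int = integrable_call[OF M] integrable_call[OF N]
    have "integral\<^sup>L M F = (\<integral>y. a \<partial>M) + b * (\<integral>y. y \<partial>M) + (\<Sum>i<m. \<integral>y. max 0 (c i * y + d i) \<partial>M)"
      unfolding F by (simp add: int)
    also have "\<dots> \<le> (\<integral>y. a \<partial>N) + b * (\<integral>y. y \<partial>N) + (\<Sum>i<m. \<integral>y. max 0 (c i * y + d i) \<partial>N)"
      unfolding mass' mean by (intro add_left_mono sum_mono call' c)
    also have "\<dots> = integral\<^sup>L N F"
      unfolding F by (simp add: int)
    finally show ?thesis unfolding F by (simp add: int)
  qed
  have \<Phi>M: "integrable M (\<Phi> n)" and \<Phi>N: "integrable N (\<Phi> n)"
    and \<Phi>_le: "integral\<^sup>L M (\<Phi> n) \<le> integral\<^sup>L N (\<Phi> n)"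
    and [measurable]: "\<Phi> n \<in> borel_measurable borel" for n
    using comb[OF \<Phi>[of n]] by auto
  \<comment> \<open>The minorant \<open>L\<close> has the same integral under both measures, and
    \<open>\<Phi> n y - L y\<close> is nonnegative, as Fatou's lemma requires.\<close>
  define L where "L = (\<lambda>y::real. \<alpha> + \<beta> * y)"
  have L: "integrable M L" "integrable N L" "integral\<^sup>L M L = integral\<^sup>L N L"
    using mass mean sp by (auto simp: L_def[abs_def] Bochner_Integration.integral_add)
  have L_le: "L y \<le> \<phi> y" for y using lb[of y 0] ub[of 0 y] by (simp add: L_def)
  show "ext_integral M \<phi> \<le> ext_integral N \<phi>"
  \<comment> \<open>The negative part of \<open>\<phi>\<close> is dominated by that of
    \<open>L\<close>, hence has finite integral. So an infinite positive part makes the right side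
    \<open>\<infinity>\<close>, and otherwise \<open>\<phi>\<close> is integrable under
    \<open>N\<close>.\<close>
  proof (cases "(\<integral>\<^sup>+y. ennreal (\<phi> y) \<partial>N) = \<infinity>")
    case True
    have "(\<integral>\<^sup>+y. ennreal (- \<phi> y) \<partial>N) \<le> (\<integral>\<^sup>+y. ennreal (- L y) \<partial>N)"
      using L_le by (intro nn_integral_mono) (simp add: ennreal_leI)
    also have "\<dots> < \<infinity>" using L(2) by (simp add: real_integrable_def less_top)
    finally have "ext_integral N \<phi> = \<infinity>"
      unfolding ext_integral_def True
      by (cases "\<integral>\<^sup>+y. ennreal (- \<phi> y) \<partial>N" rule: ennreal_cases) (auto simp: enn2ereal_ennreal)
    then show ?thesis by simp
  next
    case False
    have "(\<integral>\<^sup>+y. ennreal (- \<phi> y) \<partial>N) \<le> (\<integral>\<^sup>+y. ennreal (- L y) \<partial>N)"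
      using L_le by (intro nn_integral_mono) (simp add: ennreal_leI)
    also have "\<dots> < \<infinity>" using L(2) by (simp add: real_integrable_def less_top)
    finally have \<phi>N: "integrable N \<phi>" using False by (simp add: real_integrable_def)
    have \<Phi>L: "(\<integral>\<^sup>+y. ennreal (\<Phi> n y - L y) \<partial>M) \<le> ennreal (integral\<^sup>L N \<phi> - integral\<^sup>L N L)" for n
    proof -
      have "(\<integral>\<^sup>+y. ennreal (\<Phi> n y - L y) \<partial>M) = ennreal (\<integral>y. \<Phi> n y - L y \<partial>M)"
        using \<Phi>M L lb by (intro nn_integral_eq_integral) (auto simp: L_def)
      also have "(\<integral>y. \<Phi> n y - L y \<partial>M) = integral\<^sup>L M (\<Phi> n) - integral\<^sup>L M L"
        using \<Phi>M L by simp
      also have "integral\<^sup>L M (\<Phi> n) \<le> integral\<^sup>L N \<phi>"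
        using \<Phi>_le[of n] integral_mono[OF \<Phi>N \<phi>N ub, of n] by simp
      finally show ?thesis using L by (simp add: ennreal_leI)
    qed
    have "(\<integral>\<^sup>+y. ennreal (\<phi> y - L y) \<partial>M) = (\<integral>\<^sup>+y. liminf (\<lambda>n. ennreal (\<Phi> n y - L y)) \<partial>M)"
    proof (intro nn_integral_cong)
      fix y
      have "(\<lambda>n. ennreal (\<Phi> n y - L y)) \<longlonglongrightarrow> ennreal (\<phi> y - L y)" by (intro tendsto_intros lim)
      then show "ennreal (\<phi> y - L y) = liminf (\<lambda>n. ennreal (\<Phi> n y - L y))"
        by (simp add: lim_imp_Liminf)
    qed
    also have "\<dots> \<le> liminf (\<lambda>n. \<integral>\<^sup>+y. ennreal (\<Phi> n y - L y) \<partial>M)"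
      by (intro nn_integral_liminf) (simp add: L_def)
    also have "\<dots> \<le> ennreal (integral\<^sup>L N \<phi> - integral\<^sup>L N L)"
      using \<Phi>L by (intro Liminf_le) auto
    finally have fin: "(\<integral>\<^sup>+y. ennreal (\<phi> y - L y) \<partial>M) \<le> ennreal (integral\<^sup>L N \<phi> - integral\<^sup>L N L)" .
    \<comment> \<open>The finite bound also makes \<open>\<phi>\<close> integrable under
      \<open>M\<close>, so that both extended integrals are ordinary ones.\<close>
    have i: "integrable M (\<lambda>y. \<phi> y - L y)"
      by (rule integrableI_nonneg) (use L_le fin in \<open>auto simp: L_def intro: le_less_trans\<close>)
    have "integrable M (\<lambda>y. (\<phi> y - L y) + L y)" by (intro Bochner_Integration.integrable_add i L)
    then have \<phi>M: "integrable M \<phi>" by simp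
    have "ennreal (\<integral>y. \<phi> y - L y \<partial>M) \<le> ennreal (integral\<^sup>L N \<phi> - integral\<^sup>L N L)"
      using fin nn_integral_eq_integral[OF i] L_le by simp
    moreover have "0 \<le> integral\<^sup>L N \<phi> - integral\<^sup>L N L"
      using integral_mono[OF L(2) \<phi>N L_le] by simp
    ultimately have le: "integral\<^sup>L M \<phi> \<le> integral\<^sup>L N \<phi>"
      using \<phi>M L by simp
    have ext: "ext_integral K \<phi> = ereal (integral\<^sup>L K \<phi>)" if "integrable K \<phi>" for K
    proof -
      have "(\<integral>\<^sup>+y. ennreal (\<phi> y) \<partial>K) \<noteq> \<infinity>" "(\<integral>\<^sup>+y. ennreal (- \<phi> y) \<partial>K) \<noteq> \<infinity>"
        using that by (auto simp: real_integrable_def)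
      then show ?thesis
        unfolding ext_integral_def real_lebesgue_integral_def[OF that]
        by (cases "\<integral>\<^sup>+y. ennreal (\<phi> y) \<partial>K" rule: ennreal_cases;
            cases "\<integral>\<^sup>+y. ennreal (- \<phi> y) \<partial>K" rule: ennreal_cases) (auto simp: enn2ereal_ennreal)
    qed
    show ?thesis using le by (simp add: ext \<phi>M \<phi>N)
  qed
qed

section \<open>Martingale plans\<close>

lemma borel_measurable_fst_snd [measurable]:
  "fst \<in> (borel :: ('a::second_countable_topology \<times> 'b::second_countable_topology) measure) \<rightarrow>\<^sub>M borel"
  "snd \<in> (borel :: ('a \<times> 'b) measure) \<rightarrow>\<^sub>M borel"
  by (simp_all add: borel_prod[symmetric])

text \<open>A disintegration is specified on rectangles only. These form an intersection-stable
  generator, so \<open>\<pi>\<close> equals the measure \<open>Q\<close> composed from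
  \<open>\<mu>\<close> and the kernel that places \<open>\<kappa> x\<close> on the fibre over
  \<open>x\<close>; for \<open>Q\<close> the iterated integral is the bind formula.\<close>

lemma nn_integral_disintegration:
  assumes "disintegration \<pi> \<mu> \<kappa>" "sets \<pi> = sets borel" "sets \<mu> = sets borel" "finite_measure \<mu>"
    and [measurable]: "u \<in> borel_measurable borel"
  shows "(\<integral>\<^sup>+z. u z \<partial>\<pi>) = (\<integral>\<^sup>+x. \<integral>\<^sup>+y. u (x, y) \<partial>\<kappa> x \<partial>\<mu>)"
proof -
  have \<kappa>: "\<kappa> \<in> borel \<rightarrow>\<^sub>M prob_algebra borel"
    and rect: "\<And>A B. A \<in> sets borel \<Longrightarrow> B \<in> sets borel \<Longrightarrow>
      emeasure \<pi> (A \<times> B) = (\<integral>\<^sup>+x\<in>A. emeasure (\<kappa> x) B \<partial>\<mu>)"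
    using assms(1) unfolding disintegration_def by auto
  have [measurable_cong]: "sets \<mu> = sets borel" by fact
  have \<kappa>_sub [measurable]: "\<kappa> \<in> borel \<rightarrow>\<^sub>M subprob_algebra borel"
    by (rule measurable_prob_algebraD[OF \<kappa>])
  have [simp]: "sets (\<kappa> x) = sets borel" for x
    using measurable_space[OF \<kappa>] by (simp add: space_prob_algebra)
  have sp: "space \<mu> = UNIV" using assms(3) sets_eq_imp_space_eq[of \<mu> borel] by simp
  define k where "k = (\<lambda>x. distr (\<kappa> x) (borel :: (real \<times> real) measure) (Pair x))"
  have k_meas: "k \<in> \<mu> \<rightarrow>\<^sub>M subprob_algebra borel"
    unfolding k_def measurable_cong_sets[OF assms(3) refl]
    by (rule measurable_distr2[OF _ \<kappa>_sub]) (simp add: borel_prod)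
  define Q where "Q = \<mu> \<bind> k"
  have nnQ: "(\<integral>\<^sup>+z. v z \<partial>Q) = (\<integral>\<^sup>+x. \<integral>\<^sup>+y. v (x, y) \<partial>\<kappa> x \<partial>\<mu>)"
    if [measurable]: "v \<in> borel_measurable borel" for v
  proof -
    have [measurable]: "Pair x \<in> \<kappa> x \<rightarrow>\<^sub>M borel" for x
      by (subst measurable_cong_sets[OF \<open>sets (\<kappa> x) = sets borel\<close> refl]) measurable
    show ?thesis
      unfolding Q_def by (subst nn_integral_bind[OF that k_meas]) (simp add: k_def nn_integral_distr)
  qed
  have setsQ: "sets Q = sets borel"
    unfolding Q_def using sp by (intro sets_bind[where N=borel]) (auto simp: k_def)
  let ?E = "{A \<times> B | A B. A \<in> sets (borel :: real measure) \<and> B \<in> sets (borel :: real measure)}"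
  have gen: "sets (borel :: (real \<times> real) measure) = sigma_sets UNIV ?E"
    unfolding borel_prod[symmetric] sets_pair_measure by simp
  have "\<pi> = Q"
  proof (rule measure_eqI_generator_eq[where \<Omega>=UNIV and E="?E" and A="\<lambda>_. UNIV"])
    show "Int_stable ?E"
      using Int_stable_pair_measure_generator[of "borel :: real measure" "borel :: real measure"] by simp
    fix X assume "X \<in> ?E"
    then obtain A B where X: "X = A \<times> B" and [measurable]: "A \<in> sets borel" "B \<in> sets borel" by auto
    have "emeasure Q X = (\<integral>\<^sup>+z. indicator X z \<partial>Q)"
      by (rule nn_integral_indicator[symmetric]) (simp add: setsQ X borel_Times)
    also have "\<dots> = (\<integral>\<^sup>+x. \<integral>\<^sup>+y. indicator X (x, y) \<partial>\<kappa> x \<partial>\<mu>)"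
      unfolding X by (intro nnQ borel_measurable_indicator borel_Times) measurable
    also have "\<dots> = (\<integral>\<^sup>+x\<in>A. emeasure (\<kappa> x) B \<partial>\<mu>)"
      by (intro nn_integral_cong)
         (simp add: X indicator_times nn_integral_cmult mult.commute)
    finally show "emeasure \<pi> X = emeasure Q X" using rect X by simp
  next
    \<comment> \<open>Uniqueness from a generator needs a cover of finite measure;
      \<open>UNIV\<close> serves, being a rectangle whose mass is that of
      \<open>\<mu>\<close>.\<close>
    have "emeasure \<pi> (UNIV \<times> UNIV) = (\<integral>\<^sup>+x\<in>UNIV. emeasure (\<kappa> x) UNIV \<partial>\<mu>)"
      by (rule rect) auto
    also have "\<dots> = (\<integral>\<^sup>+x. 1 \<partial>\<mu>)"
    proof (intro nn_integral_cong)
      fix x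
      have "prob_space (\<kappa> x)" "space (\<kappa> x) = UNIV"
        using measurable_space[OF \<kappa>, of x] sets_eq_imp_space_eq[of "\<kappa> x" borel] by (auto simp: space_prob_algebra)
      then show "emeasure (\<kappa> x) UNIV * indicator UNIV x = 1"
        using prob_space.emeasure_space_1 by fastforce
    qed
    also have "\<dots> < \<infinity>" using assms(4) finite_measure.emeasure_finite[of \<mu> "space \<mu>"] by (simp add: less_top)
    finally show "emeasure \<pi> UNIV \<noteq> \<infinity>" by simp
  qed (auto simp: gen assms setsQ intro!: exI[of _ UNIV])
  then show ?thesis using nnQ[OF assms(5)] by simp
qed

lemma martingale_plans_sets:
  assumes "\<pi> \<in> \<Pi>\<^sub>M \<mu> \<nu>"
  shows "sets \<pi> = sets borel" "space \<pi> = UNIV"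
  using assms sets_eq_imp_space_eq[of \<pi> borel] by (auto simp: martingale_plans_def)

lemma integrable_martingale_plans:
  fixes f :: "real \<Rightarrow> real"
  assumes "\<pi> \<in> \<Pi>\<^sub>M \<mu> \<nu>"
  shows "integrable \<mu> f \<Longrightarrow> integrable \<pi> (\<lambda>z. f (fst z))"
    and "integrable \<nu> f \<Longrightarrow> integrable \<pi> (\<lambda>z. f (snd z))"
    and "f \<in> borel_measurable borel \<Longrightarrow> (\<integral>z. f (fst z) \<partial>\<pi>) = (\<integral>x. f x \<partial>\<mu>)"
    and "f \<in> borel_measurable borel \<Longrightarrow> (\<integral>z. f (snd z) \<partial>\<pi>) = (\<integral>y. f y \<partial>\<nu>)"
proof -
  have eq: "distr \<pi> borel fst = \<mu>" "distr \<pi> borel snd = \<nu>"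
    and [measurable_cong]: "sets \<pi> = sets borel"
    using assms by (auto simp: martingale_plans_def)
  have m: "fst \<in> \<pi> \<rightarrow>\<^sub>M borel" "snd \<in> \<pi> \<rightarrow>\<^sub>M borel" by measurable
  show "integrable \<mu> f \<Longrightarrow> integrable \<pi> (\<lambda>z. f (fst z))"
    using integrable_distr[OF m(1), of f] unfolding eq .
  show "integrable \<nu> f \<Longrightarrow> integrable \<pi> (\<lambda>z. f (snd z))"
    using integrable_distr[OF m(2), of f] unfolding eq .
  show "f \<in> borel_measurable borel \<Longrightarrow> (\<integral>z. f (fst z) \<partial>\<pi>) = (\<integral>x. f x \<partial>\<mu>)"
    using integral_distr[OF m(1), of f] unfolding eq by simp
  show "f \<in> borel_measurable borel \<Longrightarrow> (\<integral>z. f (snd z) \<partial>\<pi>) = (\<integral>y. f y \<partial>\<nu>)"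
    using integral_distr[OF m(2), of f] unfolding eq by simp
qed

lemma prob_algebra_kernel:
  assumes "\<kappa> \<in> borel \<rightarrow>\<^sub>M prob_algebra borel"
  shows "sets (\<kappa> x) = sets borel" "space (\<kappa> x) = UNIV" "prob_space (\<kappa> x)"
  using measurable_space[OF assms, of x] sets_eq_imp_space_eq[of "\<kappa> x" borel]
  by (auto simp: space_prob_algebra)

text \<open>Given \<open>x\<close>, the increment is centred and the indicator is constant along the
  fibre. The disintegration formula covers nonnegative integrands, so the positive and negative
  parts are integrated separately and found equal.\<close>

lemma martingale_increment_zero:
  assumes \<pi>: "\<pi> \<in> \<Pi>\<^sub>M \<mu> \<nu>" and m: "finite_first_moment \<mu>" "finite_first_moment \<nu>"
    and A [measurable]: "A \<in> sets borel"
  shows "integrable \<pi> (\<lambda>z. indicator A (fst z) * (snd z - fst z))"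
    and "(\<integral>z. indicator A (fst z) * (snd z - fst z) \<partial>\<pi>) = 0"
proof -
  obtain \<kappa> where dis: "disintegration \<pi> \<mu> \<kappa>"
    and mean: "AE x in \<mu>. integrable (\<kappa> x) (\<lambda>y. y) \<and> (\<integral>y. y \<partial>(\<kappa> x)) = x"
    using \<pi> by (auto simp: martingale_plans_def)
  note K = prob_algebra_kernel[of \<kappa>]
  have \<kappa>: "\<kappa> \<in> borel \<rightarrow>\<^sub>M prob_algebra borel" using dis by (simp add: disintegration_def)
  have S [measurable_cong]: "sets \<pi> = sets borel" using martingale_plans_sets[OF \<pi>] by simp
  have nn: "(\<integral>\<^sup>+z. u z \<partial>\<pi>) = (\<integral>\<^sup>+x. \<integral>\<^sup>+y. u (x, y) \<partial>\<kappa> x \<partial>\<mu>)"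
    if "u \<in> borel_measurable borel" for u
    using nn_integral_disintegration[OF dis S _ _ that] m by (auto simp: finite_first_moment_def)
  show int: "integrable \<pi> (\<lambda>z. indicator A (fst z) * (snd z - fst z))"
  proof (rule Bochner_Integration.integrable_bound)
    show "integrable \<pi> (\<lambda>z. \<bar>snd z\<bar> + \<bar>fst z\<bar>)"
      using m by (intro Bochner_Integration.integrable_add integrable_abs
        integrable_martingale_plans[OF \<pi>]) (auto simp: finite_first_moment_def)
  qed (auto simp: indicator_def)
  have "(\<integral>\<^sup>+z. ennreal (indicator A (fst z) * (snd z - fst z)) \<partial>\<pi>) =
        (\<integral>\<^sup>+z. ennreal (- (indicator A (fst z) * (snd z - fst z))) \<partial>\<pi>)"
  proof (subst (1 2) nn)
    show "(\<integral>\<^sup>+x. \<integral>\<^sup>+y. ennreal (indicator A (fst (x, y)) * (snd (x, y) - fst (x, y))) \<partial>\<kappa> x \<partial>\<mu>) =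
      (\<integral>\<^sup>+x. \<integral>\<^sup>+y. ennreal (- (indicator A (fst (x, y)) * (snd (x, y) - fst (x, y)))) \<partial>\<kappa> x \<partial>\<mu>)"
    proof (rule nn_integral_cong_AE, rule AE_mp[OF mean], rule AE_I2, rule impI)
      fix x assume x: "integrable (\<kappa> x) (\<lambda>y. y) \<and> (\<integral>y. y \<partial>(\<kappa> x)) = x"
      interpret prob_space "\<kappa> x" by (rule K[OF \<kappa>])
      let ?g = "\<lambda>y. indicator A x * (y - x)"
      have i: "integrable (\<kappa> x) ?g" using x by auto
      have "(\<integral>y. ?g y \<partial>\<kappa> x) = 0"
        using x by (simp add: Bochner_Integration.integral_diff prob_space)
      then have "enn2real (\<integral>\<^sup>+y. ennreal (?g y) \<partial>\<kappa> x) = enn2real (\<integral>\<^sup>+y. ennreal (- ?g y) \<partial>\<kappa> x)"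
        unfolding real_lebesgue_integral_def[OF i] by linarith
      \<comment> \<open>\<open>enn2real\<close> sends \<open>\<infinity>\<close> to 0, so finiteness
        of both parts is what lifts the equality back to \<open>ennreal\<close>.\<close>
      moreover have "(\<integral>\<^sup>+y. ennreal (?g y) \<partial>\<kappa> x) \<noteq> \<infinity>" "(\<integral>\<^sup>+y. ennreal (- ?g y) \<partial>\<kappa> x) \<noteq> \<infinity>"
        using real_integrable_def[THEN iffD1, OF i] by blast+
      ultimately have "(\<integral>\<^sup>+y. ennreal (?g y) \<partial>\<kappa> x) = (\<integral>\<^sup>+y. ennreal (- ?g y) \<partial>\<kappa> x)"
        by (metis ennreal_enn2real infinity_ennreal_def less_top)
      then show "(\<integral>\<^sup>+y. ennreal (indicator A (fst (x, y)) * (snd (x, y) - fst (x, y))) \<partial>\<kappa> x) =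
        (\<integral>\<^sup>+y. ennreal (- (indicator A (fst (x, y)) * (snd (x, y) - fst (x, y)))) \<partial>\<kappa> x)"
        by simp
    qed
  qed (use borel_measurable_indicator[of A borel] in measurable)
  then show "(\<integral>z. indicator A (fst z) * (snd z - fst z) \<partial>\<pi>) = 0"
    by (simp add: real_lebesgue_integral_def[OF int])
qed

section \<open>Left-monotone plans\<close>

lemma snd_marginal_upto_integral:
  fixes f :: "real \<Rightarrow> real"
  assumes S: "sets \<pi> = sets borel" and [measurable]: "f \<in> borel_measurable borel"
  shows "integral\<^sup>L (snd_marginal_upto \<pi> t) f = (\<integral>z. indicator {..t} (fst z) * f (snd z) \<partial>\<pi>)"
    and "integrable (snd_marginal_upto \<pi> t) f \<longleftrightarrow> integrable \<pi> (\<lambda>z. indicator {..t} (fst z) * f (snd z))"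
proof -
  have [measurable_cong]: "sets \<pi> = sets borel" by fact
  have sp: "space \<pi> = UNIV" using S sets_eq_imp_space_eq[of \<pi> borel] by simp
  have m: "snd \<in> restrict_space \<pi> ({..t} \<times> UNIV) \<rightarrow>\<^sub>M borel"
    by (rule measurable_restrict_space1) measurable
  have A: "{..t} \<times> UNIV \<inter> space \<pi> \<in> sets \<pi>"
    unfolding S sp by (simp add: borel_Times)
  have i: "indicator ({..t} \<times> UNIV) z = (indicator {..t} (fst z) :: real)" for z :: "real \<times> real"
    by (cases z) (simp add: indicator_def)
  show "integral\<^sup>L (snd_marginal_upto \<pi> t) f = (\<integral>z. indicator {..t} (fst z) * f (snd z) \<partial>\<pi>)"
    unfolding snd_marginal_upto_def
    by (subst integral_distr[OF m]) (auto simp: integral_restrict_space[OF A] i)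
  show "integrable (snd_marginal_upto \<pi> t) f \<longleftrightarrow> integrable \<pi> (\<lambda>z. indicator {..t} (fst z) * f (snd z))"
    unfolding snd_marginal_upto_def
    by (subst integrable_distr_eq[OF m]) (auto simp: integrable_restrict_space[OF A] i)
qed

text \<open>Mass and mean come out in terms of \<open>\<mu>\<close> and \<open>t\<close> alone,
  hence agree for all plans, as \<open>convex_order_if_calls\<close> demands. For the mean, the
  increment over starting points in \<open>{..t}\<close> integrates to zero.\<close>

lemma snd_marginal_upto_martingale_plan:
  assumes \<pi>: "\<pi> \<in> \<Pi>\<^sub>M \<mu> \<nu>" and m: "finite_first_moment \<mu>" "finite_first_moment \<nu>"
  shows "finite_first_moment (snd_marginal_upto \<pi> t)"
    and "measure (snd_marginal_upto \<pi> t) UNIV = measure \<mu> {..t}"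
    and "(\<integral>y. y \<partial>snd_marginal_upto \<pi> t) = (\<integral>x. indicator {..t} x * x \<partial>\<mu>)"
proof -
  let ?N = "snd_marginal_upto \<pi> t"
  have S [measurable_cong]: "sets \<pi> = sets borel" and sp: "space \<pi> = UNIV"
    using martingale_plans_sets[OF \<pi>] by auto
  have snd_m: "snd \<in> restrict_space \<pi> ({..t} \<times> UNIV) \<rightarrow>\<^sub>M borel"
    by (rule measurable_restrict_space1) measurable
  have \<mu>: "distr \<pi> borel fst = \<mu>" using \<pi> by (auto simp: martingale_plans_def)
  have fin: "finite_measure \<mu>" and [measurable_cong]: "sets \<mu> = sets borel"
    and id\<mu>: "integrable \<mu> (\<lambda>x. x)" and id\<nu>: "integrable \<nu> (\<lambda>x. x)"
    using m by (auto simp: finite_first_moment_def)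
  interpret \<mu>: finite_measure \<mu> by fact
  have "emeasure ?N UNIV = emeasure \<pi> ({..t} \<times> UNIV)"
    unfolding snd_marginal_upto_def
    by (subst emeasure_distr[OF snd_m])
       (auto simp: space_restrict_space sp S borel_Times intro!: emeasure_restrict_space)
  also have "\<dots> = emeasure \<mu> {..t}"
    unfolding \<mu>[symmetric] by (subst emeasure_distr) (auto simp: sp vimage_fst)
  finally have e: "emeasure ?N UNIV = emeasure \<mu> {..t}" .
  then show "measure ?N UNIV = measure \<mu> {..t}" by (simp add: measure_def)
  have "finite_measure ?N"
    by (rule finite_measureI) (use e in \<open>simp add: snd_marginal_upto_def\<close>)
  moreover have i: "integrable \<pi> (\<lambda>z. indicator {..t} (fst z) * snd z)"
    by (rule Bochner_Integration.integrable_bound[OF integrable_martingale_plans(2)[OF \<pi> id\<nu>]])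
       (auto simp: indicator_def)
  ultimately show "finite_first_moment ?N"
    unfolding finite_first_moment_def by (simp add: snd_marginal_upto_integral S) (simp add: snd_marginal_upto_def)
  have "integrable \<mu> (\<lambda>x. indicator {..t} x * x)"
    by (rule Bochner_Integration.integrable_bound[OF id\<mu>]) (auto simp: indicator_def)
  note i' = integrable_martingale_plans(1)[OF \<pi> this]
  have "(\<integral>z. indicator {..t} (fst z) * (snd z - fst z) \<partial>\<pi>) =
     (\<integral>z. indicator {..t} (fst z) * snd z \<partial>\<pi>) - (\<integral>z. indicator {..t} (fst z) * fst z \<partial>\<pi>)"
    using i i' by (subst Bochner_Integration.integral_diff[symmetric]) (auto simp: algebra_simps)
  then have "(\<integral>z. indicator {..t} (fst z) * snd z \<partial>\<pi>) = (\<integral>z. indicator {..t} (fst z) * fst z \<partial>\<pi>)"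
    using martingale_increment_zero(2)[OF \<pi> m, of "{..t}"] by simp
  also have "\<dots> = (\<integral>x. indicator {..t} x * x \<partial>\<mu>)"
    by (rule integrable_martingale_plans(3)[OF \<pi>]) simp
  finally show "(\<integral>y. y \<partial>?N) = (\<integral>x. indicator {..t} x * x \<partial>\<mu>)"
    by (simp add: snd_marginal_upto_integral S)
qed

section \<open>Jensen's inequality for calls\<close>

text \<open>The excess in the tangent inequality at \<open>fst z\<close> for the call with strike \<open>p\<close>.\<close>

definition call_gap :: "real \<Rightarrow> real \<times> real \<Rightarrow> real" where
  "call_gap p z = max 0 (snd z - p) - max 0 (fst z - p) - indicator {p<..} (fst z) * (snd z - fst z)"

lemma call_gap_nonneg: "0 \<le> call_gap p z"
  by (auto simp: call_gap_def indicator_def max_def)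

lemma call_gap_measurable [measurable]: "call_gap p \<in> borel_measurable borel"
  unfolding call_gap_def[abs_def] by measurable

text \<open>The linear term of the gap is a martingale increment and integrates to zero. What
  remains is the excess of the call integral over Jensen's lower bound, and that bound is the same
  for every plan.\<close>

lemma integral_call_gap:
  assumes \<pi>: "\<pi> \<in> \<Pi>\<^sub>M \<mu> \<nu>" and m: "finite_first_moment \<mu>" "finite_first_moment \<nu>"
  shows "(\<integral>z. indicator {..t} (fst z) * call_gap p z \<partial>\<pi>) =
    (\<integral>y. max 0 (y - p) \<partial>snd_marginal_upto \<pi> t) - (\<integral>x. indicator {..t} x * max 0 (x - p) \<partial>\<mu>)"
proof -
  have S [measurable_cong]: "sets \<pi> = sets borel" using martingale_plans_sets[OF \<pi>] by auto
  have [measurable_cong]: "sets \<mu> = sets borel" using m by (auto simp: finite_first_moment_def)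
  have c: "integrable \<mu> (\<lambda>x. max 0 (x - p))" "integrable \<nu> (\<lambda>x. max 0 (x - p))"
    using integrable_call[of _ 1 "- p"] m by auto
  have i1: "integrable \<pi> (\<lambda>z. indicator {..t} (fst z) * max 0 (snd z - p))"
    by (rule Bochner_Integration.integrable_bound[OF integrable_martingale_plans(2)[OF \<pi> c(2)]])
       (auto simp: indicator_def)
  have "integrable \<mu> (\<lambda>x. indicator {..t} x * max 0 (x - p))"
    by (rule Bochner_Integration.integrable_bound[OF c(1)]) (auto simp: indicator_def)
  note i2 = integrable_martingale_plans(1)[OF \<pi> this]
  \<comment> \<open>The indicators of \<open>{..t}\<close> and \<open>{p<..}\<close> multiply to
    that of \<open>{p<..t}\<close>.\<close>
  note i3 = martingale_increment_zero[OF \<pi> m, of "{p<..t}"]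
  have "(\<integral>z. indicator {..t} (fst z) * call_gap p z \<partial>\<pi>) =
    (\<integral>z. indicator {..t} (fst z) * max 0 (snd z - p) - indicator {..t} (fst z) * max 0 (fst z - p)
      - indicator {p<..t} (fst z) * (snd z - fst z) \<partial>\<pi>)"
    by (intro Bochner_Integration.integral_cong) (auto simp: call_gap_def indicator_def)
  also have "\<dots> = (\<integral>z. indicator {..t} (fst z) * max 0 (snd z - p) \<partial>\<pi>)
      - (\<integral>z. indicator {..t} (fst z) * max 0 (fst z - p) \<partial>\<pi>)"
    using i1 i2 i3 by simp
  also have "(\<integral>z. indicator {..t} (fst z) * max 0 (fst z - p) \<partial>\<pi>) = (\<integral>x. indicator {..t} x * max 0 (x - p) \<partial>\<mu>)"
    by (rule integrable_martingale_plans(3)[OF \<pi>]) simp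
  finally show ?thesis by (simp add: snd_marginal_upto_integral S)
qed

lemma call_upto_ge:
  assumes "\<pi> \<in> \<Pi>\<^sub>M \<mu> \<nu>" "finite_first_moment \<mu>" "finite_first_moment \<nu>"
  shows "(\<integral>x. indicator {..t} x * max 0 (x - p) \<partial>\<mu>) \<le> (\<integral>y. max 0 (y - p) \<partial>snd_marginal_upto \<pi> t)"
proof -
  have "0 \<le> (\<integral>z. indicator {..t} (fst z) * call_gap p z \<partial>\<pi>)"
    by (intro Bochner_Integration.integral_nonneg mult_nonneg_nonneg call_gap_nonneg) simp
  then show ?thesis unfolding integral_call_gap[OF assms] by simp
qed

section \<open>Strikes outside the fibre hulls: equality in Jensen's inequality\<close>

text \<open>Written as a union of open intervals between two points of a fibre, so that openness is
  immediate.\<close>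

definition hulls_upto :: "(real \<times> real) set \<Rightarrow> real \<Rightarrow> real set" where
  "hulls_upto \<Gamma> t = (\<Union>(x, y)\<in>{z \<in> \<Gamma>. fst z \<le> t}. \<Union>(x', y')\<in>{z \<in> \<Gamma>. fst z = x}. {y<..<y'})"

lemma mem_hulls_upto:
  "p \<in> hulls_upto \<Gamma> t \<longleftrightarrow> (\<exists>x y y'. x \<le> t \<and> (x, y) \<in> \<Gamma> \<and> (x, y') \<in> \<Gamma> \<and> y < p \<and> p < y')"
  by (fastforce simp: hulls_upto_def)

lemma open_hulls_upto: "open (hulls_upto \<Gamma> t)"
  unfolding hulls_upto_def by (auto intro!: open_UN)

text \<open>The equality case of \<open>call_upto_ge\<close>: almost every fibre over
  \<open>x \<le> t\<close> lies on one side of \<open>p\<close>, and so does its barycentre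
  \<open>x\<close>. The call is affine there, and the gap has integral 0.\<close>

lemma call_upto_eq:
  assumes \<pi>: "\<pi> \<in> \<Pi>\<^sub>M \<mu> \<nu>" and m: "finite_first_moment \<mu>" "finite_first_moment \<nu>"
    and \<Gamma>: "\<Gamma> \<in> sets borel" "AE z in \<pi>. z \<in> \<Gamma>" and p: "p \<notin> hulls_upto \<Gamma> t"
  shows "(\<integral>y. max 0 (y - p) \<partial>snd_marginal_upto \<pi> t) = (\<integral>x. indicator {..t} x * max 0 (x - p) \<partial>\<mu>)"
proof -
  obtain \<kappa> where dis: "disintegration \<pi> \<mu> \<kappa>"
    and mean: "AE x in \<mu>. integrable (\<kappa> x) (\<lambda>y. y) \<and> (\<integral>y. y \<partial>(\<kappa> x)) = x"
    using \<pi> by (auto simp: martingale_plans_def)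
  have \<kappa>: "\<kappa> \<in> borel \<rightarrow>\<^sub>M prob_algebra borel" using dis by (simp add: disintegration_def)
  note K = prob_algebra_kernel[OF \<kappa>]
  have S [measurable_cong]: "sets \<pi> = sets borel" using martingale_plans_sets[OF \<pi>] by simp
  have \<mu>S [measurable_cong]: "sets \<mu> = sets borel" using m by (auto simp: finite_first_moment_def)
  have [measurable_cong]: "sets (\<kappa> x) = sets borel" for x by (rule K)
  note [measurable] = \<Gamma>(1) measurable_prob_algebraD[OF \<kappa>]
  have nn: "(\<integral>\<^sup>+z. u z \<partial>\<pi>) = (\<integral>\<^sup>+x. \<integral>\<^sup>+y. u (x, y) \<partial>\<kappa> x \<partial>\<mu>)"
    if "u \<in> borel_measurable borel" for u
    using nn_integral_disintegration[OF dis S _ _ that] m by (auto simp: finite_first_moment_def)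
  have sec [measurable]: "Pair x \<in> borel \<rightarrow>\<^sub>M (borel :: (real \<times> real) measure)" for x :: real
    by (simp add: borel_prod[symmetric])
  \<comment> \<open>Concentration on \<open>\<Gamma>\<close> passes to the fibres: a null set has
    null sections over almost every \<open>x\<close>.\<close>
  have "(\<integral>\<^sup>+z. indicator (- \<Gamma>) z \<partial>\<pi>) = 0"
    using \<Gamma>(2) by (subst nn_integral_0_iff_AE) (auto simp: indicator_def)
  then have "(\<integral>\<^sup>+x. \<integral>\<^sup>+y. indicator (- \<Gamma>) (x, y) \<partial>\<kappa> x \<partial>\<mu>) = 0"
    by (subst (asm) nn) auto
  moreover have "(\<lambda>x. \<integral>\<^sup>+y. indicator (- \<Gamma>) (x, y) \<partial>\<kappa> x) \<in> borel_measurable \<mu>"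
    unfolding measurable_cong_sets[OF \<mu>S refl]
    by (rule nn_integral_measurable_subprob_algebra2[where N=borel]) (simp_all add: borel_prod split_beta')
  ultimately have "AE x in \<mu>. (\<integral>\<^sup>+y. indicator (- \<Gamma>) (x, y) \<partial>\<kappa> x) = 0"
    by (subst (asm) nn_integral_0_iff_AE) auto
  then have conc: "AE x in \<mu>. AE y in \<kappa> x. (x, y) \<in> \<Gamma>"
  proof eventually_elim
    case (elim x)
    then have "AE y in \<kappa> x. indicator (- \<Gamma>) (x, y) = (0 :: ennreal)"
      by (subst (asm) nn_integral_0_iff_AE) auto
    then show ?case by (auto simp: indicator_def)
  qed
  have zero: "(\<integral>\<^sup>+y. ennreal (call_gap p (x, y)) \<partial>\<kappa> x) = 0"
    if x: "integrable (\<kappa> x) (\<lambda>y. y)" "(\<integral>y. y \<partial>(\<kappa> x)) = x" "AE y in \<kappa> x. (x, y) \<in> \<Gamma>" "x \<le> t" for x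
  proof -
    interpret prob_space "\<kappa> x" by (rule K)
    have int: "integrable (\<kappa> x) (\<lambda>y. a * (y - p))" "(\<integral>y. a * (y - p) \<partial>\<kappa> x) = a * (x - p)" for a
      using x by (simp_all add: prob_space)
    \<comment> \<open>Each fibre of \<open>\<Gamma>\<close> lies on one side of \<open>p\<close>, so the gap is either zero or linear
      along it; in the linear case its mean is nonpositive.\<close>
    have lin: ?thesis if a: "AE y in \<kappa> x. call_gap p (x, y) = a * (y - p)" "a * (x - p) \<le> 0" for a
    proof -
      have "(\<integral>\<^sup>+y. ennreal (call_gap p (x, y)) \<partial>\<kappa> x) = (\<integral>\<^sup>+y. ennreal (a * (y - p)) \<partial>\<kappa> x)"
        using a(1) by (intro nn_integral_cong_AE) auto
      also have "\<dots> = ennreal (\<integral>y. a * (y - p) \<partial>\<kappa> x)"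
      proof (rule nn_integral_eq_integral[OF int(1)])
        show "AE y in \<kappa> x. 0 \<le> a * (y - p)" using a(1) call_gap_nonneg[of p] by (auto elim!: eventually_mono) (metis)
      qed
      also have "\<dots> = 0" unfolding int using a(2) by (simp add: ennreal_neg)
      finally show ?thesis .
    qed
    have side: "(\<forall>y. (x, y) \<in> \<Gamma> \<longrightarrow> y \<le> p) \<or> (\<forall>y. (x, y) \<in> \<Gamma> \<longrightarrow> p \<le> y)"
      using p x(4) unfolding mem_hulls_upto by (meson not_le)
    then consider "AE y in \<kappa> x. y \<le> p" | "AE y in \<kappa> x. p \<le> y"
      using eventually_mono[OF x(3)] by (metis (no_types, lifting))
    then show ?thesis
    proof cases
      case 1
      \<comment> \<open>For \<open>y \<le> p\<close> the gap is \<open>p - y\<close> if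
        \<open>p < x\<close> and 0 otherwise; for \<open>p \<le> y\<close> it is
        \<open>y - p\<close> if \<open>x \<le> p\<close> and 0 otherwise. This gives the
        coefficients in both cases.\<close>
      show ?thesis
        by (rule lin[of "if x > p then - 1 else 0"])
           (use 1 in \<open>auto simp: call_gap_def elim!: eventually_mono\<close>)
    next
      case 2
      show ?thesis
        by (rule lin[of "if x > p then 0 else 1"])
           (use 2 in \<open>auto simp: call_gap_def elim!: eventually_mono\<close>)
    qed
  qed
  have "(\<integral>\<^sup>+z. ennreal (indicator {..t} (fst z) * call_gap p z) \<partial>\<pi>) =
      (\<integral>\<^sup>+x. \<integral>\<^sup>+y. ennreal (indicator {..t} (fst (x, y)) * call_gap p (x, y)) \<partial>\<kappa> x \<partial>\<mu>)"
    by (rule nn) measurable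
  also have "\<dots> = (\<integral>\<^sup>+x. 0 \<partial>\<mu>)"
  proof (rule nn_integral_cong_AE, use mean conc in eventually_elim)
    fix x assume x: "integrable (\<kappa> x) (\<lambda>y. y) \<and> (\<integral>y. y \<partial>(\<kappa> x)) = x" "AE y in \<kappa> x. (x, y) \<in> \<Gamma>"
    show "(\<integral>\<^sup>+y. ennreal (indicator {..t} (fst (x, y)) * call_gap p (x, y)) \<partial>\<kappa> x) = 0"
      using zero[of x] x by (cases "x \<le> t") auto
  qed
  finally have "(\<integral>\<^sup>+z. ennreal (indicator {..t} (fst z) * call_gap p z) \<partial>\<pi>) = 0" by simp
  moreover have "(\<integral>z. indicator {..t} (fst z) * call_gap p z \<partial>\<pi>) =
      enn2real (\<integral>\<^sup>+z. ennreal (indicator {..t} (fst z) * call_gap p z) \<partial>\<pi>)"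
    by (rule integral_eq_nn_integral) (auto simp: call_gap_nonneg)
  ultimately show ?thesis using integral_call_gap[OF \<pi> m, of t p] by simp
qed

section \<open>Comparison of calls at all strikes\<close>

lemma calls_upto_ordered:
  assumes \<pi>lc: "\<pi>lc \<in> \<Pi>\<^sub>M \<mu> \<nu>" and \<pi>: "\<pi> \<in> \<Pi>\<^sub>M \<mu> \<nu>"
    and m: "finite_first_moment \<mu>" "finite_first_moment \<nu>"
    and \<Gamma>: "\<Gamma> \<in> sets borel" "AE z in \<pi>lc. z \<in> \<Gamma>"
    and mono: "\<forall>x ym yp x' y'. (x, ym) \<in> \<Gamma> \<and> (x, yp) \<in> \<Gamma> \<and> (x', y') \<in> \<Gamma> \<longrightarrow>
        \<not> (x < x' \<and> ym < y' \<and> y' < yp)"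
  shows "(\<integral>y. max 0 (y - k) \<partial>snd_marginal_upto \<pi>lc t) \<le> (\<integral>y. max 0 (y - k) \<partial>snd_marginal_upto \<pi> t)"
proof -
  let ?M = "snd_marginal_upto \<pi>lc t" and ?N = "snd_marginal_upto \<pi> t"
  define U where "U = hulls_upto \<Gamma> t"
  have S [measurable_cong]: "sets \<pi>lc = sets borel" "sets \<pi> = sets borel"
    using martingale_plans_sets \<pi>lc \<pi> by auto
  have [measurable_cong]: "sets \<mu> = sets borel" "sets \<nu> = sets borel"
    using m by (auto simp: finite_first_moment_def)
  note M = snd_marginal_upto_martingale_plan[OF \<pi>lc m, of t]
  note N = snd_marginal_upto_martingale_plan[OF \<pi> m, of t]
  have cM [simp]: "integrable ?M (\<lambda>y. max 0 (y - p))" for p using integrable_call[OF M(1), of 1 "- p"] by simp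
  have cN [simp]: "integrable ?N (\<lambda>y. max 0 (y - p))" for p using integrable_call[OF N(1), of 1 "- p"] by simp
  have c\<nu> [simp]: "integrable \<nu> (\<lambda>y. max 0 (y - p))" for p using integrable_call[OF m(2), of 1 "- p"] by simp
  interpret M: finite_measure ?M using M(1) by (simp add: finite_first_moment_def)
  interpret N: finite_measure ?N using N(1) by (simp add: finite_first_moment_def)
  interpret \<nu>: finite_measure \<nu> using m(2) by (simp add: finite_first_moment_def)
  have const: "(\<integral>y. r \<partial>?M) = (\<integral>y. r \<partial>?N)" for r :: real
    using M(2) N(2) by (simp add: snd_marginal_upto_def)
  have call_le: "(\<integral>y. max 0 (y - p) \<partial>?M) \<le> (\<integral>y. max 0 (y - p) \<partial>?N)" if "p \<notin> U" for p
    using call_upto_eq[OF \<pi>lc m \<Gamma> that[unfolded U_def]] call_upto_ge[OF \<pi> m] by simp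
  \<comment> \<open>A landing point in \<open>U\<close> lies strictly between two points of a fibre
    over some \<open>x \<le> t < fst z\<close>, which monotonicity of \<open>\<Gamma>\<close>
    forbids.\<close>
  have after: "AE z in \<pi>lc. t < fst z \<longrightarrow> snd z \<notin> U"
    using \<Gamma>(2)
  proof eventually_elim
    case (elim z)
    show ?case
    proof (intro impI notI)
      assume "t < fst z" "snd z \<in> U"
      then obtain x y y' where "x < fst z" "(x, y) \<in> \<Gamma>" "(x, y') \<in> \<Gamma>" "y < snd z" "snd z < y'"
        unfolding U_def mem_hulls_upto by (metis le_less_trans)
      with elim mono show False by (metis prod.collapse)
    qed
  qed
  \<comment> \<open>The curtain plan transports everything that \<open>\<nu>\<close> has on \<open>U\<close> from \<open>{..t}\<close>.\<close>
  have on_U: "integral\<^sup>L ?N g \<le> integral\<^sup>L ?M g"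
    if g: "integrable \<nu> g" "\<And>y. 0 \<le> g y" "\<And>y. y \<notin> U \<Longrightarrow> g y = 0" for g :: "real \<Rightarrow> real"
  proof -
    have [measurable]: "g \<in> borel_measurable borel" using borel_measurable_integrable[OF g(1)] by measurable
    have "integral\<^sup>L ?N g = (\<integral>z. indicator {..t} (fst z) * g (snd z) \<partial>\<pi>)"
      by (simp add: snd_marginal_upto_integral S)
    also have "\<dots> \<le> (\<integral>z. g (snd z) \<partial>\<pi>)"
      using g(2) by (intro integral_mono_AE' integrable_martingale_plans(2)[OF \<pi> g(1)] AE_I2) (auto simp: indicator_def)
    \<comment> \<open>Without the restriction to \<open>{..t}\<close> both integrals depend on the
      common second marginal \<open>\<nu>\<close> only.\<close>
    also have "\<dots> = (\<integral>z. g (snd z) \<partial>\<pi>lc)"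
      by (simp add: integrable_martingale_plans(4)[OF \<pi>] integrable_martingale_plans(4)[OF \<pi>lc])
    also have "\<dots> = (\<integral>z. indicator {..t} (fst z) * g (snd z) \<partial>\<pi>lc)"
      using after g(3) by (intro integral_cong_AE) (auto simp: indicator_def elim!: eventually_mono)
    also have "\<dots> = integral\<^sup>L ?M g"
      by (simp add: snd_marginal_upto_integral S)
    finally show ?thesis .
  qed
  \<comment> \<open>Hence it suffices to dominate the call at \<open>k\<close> by a combination of calls with strikes outside
    \<open>U\<close> that differs from it on \<open>U\<close> only.\<close>
  have dominate: ?thesis
    if s: "0 \<le> s1" "0 \<le> s2" "s1 \<noteq> 0 \<Longrightarrow> a \<notin> U" "s2 \<noteq> 0 \<Longrightarrow> b \<notin> U"
      and f: "\<And>y. f y = r + s1 * max 0 (y - a) + s2 * max 0 (y - b)"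
      and ge: "\<And>y. max 0 (y - k) \<le> f y" and eq: "\<And>y. y \<notin> U \<Longrightarrow> f y = max 0 (y - k)"
    for s1 s2 a b r :: real and f
  proof -
    have mult: "s * (\<integral>y. max 0 (y - p) \<partial>?M) \<le> s * (\<integral>y. max 0 (y - p) \<partial>?N)"
      if "0 \<le> s" "s \<noteq> 0 \<Longrightarrow> p \<notin> U" for s p
      using that call_le[of p] by (cases "s = 0") (auto intro: mult_left_mono)
    have f': "f = (\<lambda>y. r + s1 * max 0 (y - a) + s2 * max 0 (y - b))" using f by auto
    have "integral\<^sup>L ?M f = (\<integral>y. r \<partial>?M) + s1 * (\<integral>y. max 0 (y - a) \<partial>?M) + s2 * (\<integral>y. max 0 (y - b) \<partial>?M)"
      unfolding f' by simp
    also have "\<dots> \<le> (\<integral>y. r \<partial>?N) + s1 * (\<integral>y. max 0 (y - a) \<partial>?N) + s2 * (\<integral>y. max 0 (y - b) \<partial>?N)"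
      unfolding const by (intro add_mono order_refl mult s)
    also have "\<dots> = integral\<^sup>L ?N f" unfolding f' by simp
    finally have 1: "integral\<^sup>L ?M f \<le> integral\<^sup>L ?N f" .
    have i: "integrable ?M f" "integrable ?N f" "integrable \<nu> f" unfolding f' by auto
    have "(\<integral>y. f y - max 0 (y - k) \<partial>?N) \<le> (\<integral>y. f y - max 0 (y - k) \<partial>?M)"
      using i ge eq by (intro on_U) auto
    then show ?thesis using 1 i by simp
  qed
  have closed: "closed (- U)" by (simp add: U_def closed_def open_hulls_upto)
  \<comment> \<open>The right end of the component of \<open>k\<close>: it lies outside
    \<open>U\<close> because the complement is closed, and so can serve as a strike.\<close>
  have right: "\<exists>b>k. b \<notin> U \<and> {k..<b} \<subseteq> U" if "k \<in> U" "y \<notin> U" "k < y" for y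
  proof -
    define b where "b = Inf (- U \<inter> {k..})"
    have "b \<in> - U \<inter> {k..}" unfolding b_def
      using that closed by (intro closed_contains_Inf closed_Int) auto
    moreover have "b \<le> z" if "z \<notin> U" "k \<le> z" for z
      unfolding b_def using that by (intro cInf_lower) (auto intro: bdd_belowI)
    ultimately show ?thesis using \<open>k \<in> U\<close> by (intro exI[of _ b]) (force simp: less_le)
  qed
  have left: "\<exists>a<k. a \<notin> U \<and> {a<..k} \<subseteq> U" if "k \<in> U" "y \<notin> U" "y < k" for y
  proof -
    define a where "a = Sup (- U \<inter> {..k})"
    have "a \<in> - U \<inter> {..k}" unfolding a_def
      using that closed by (intro closed_contains_Sup closed_Int) auto
    moreover have "z \<le> a" if "z \<notin> U" "z \<le> k" for z
      unfolding a_def using that by (intro cSup_upper) (auto intro: bdd_aboveI)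
    ultimately show ?thesis using \<open>k \<in> U\<close> by (intro exI[of _ a]) (force simp: less_le)
  qed
  \<comment> \<open>If \<open>k\<close> is in \<open>U\<close>, its component is an open interval;
    the remaining cases tell which of its ends are finite.\<close>
  consider "k \<notin> U" | "U = UNIV"
    | a b where "a < k" "k < b" "a \<notin> U" "b \<notin> U" "{a<..<b} \<subseteq> U"
    | b where "k < b" "b \<notin> U" "{..<b} \<subseteq> U"
    | a where "a < k" "a \<notin> U" "{a<..} \<subseteq> U"
  proof (cases "k \<in> U")
    case True
    show thesis
    proof (cases "\<exists>y<k. y \<notin> U"; cases "\<exists>y>k. y \<notin> U")
      assume "\<exists>y<k. y \<notin> U" "\<exists>y>k. y \<notin> U"
      then obtain a b where "a < k" "a \<notin> U" "{a<..k} \<subseteq> U" "k < b" "b \<notin> U" "{k..<b} \<subseteq> U"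
        using left right True by blast
      moreover from this have "{a<..<b} \<subseteq> U" by (auto simp: subset_iff) (meson linorder_le_cases)
      ultimately show thesis using that(3) by blast
    next
      assume r: "\<exists>y<k. y \<notin> U" "\<not> (\<exists>y>k. y \<notin> U)"
      then obtain a where "a < k" "a \<notin> U" "{a<..k} \<subseteq> U"
        using left True by blast
      moreover from this have "{a<..} \<subseteq> U" using r by (auto simp: subset_iff) (meson not_le)
      ultimately show thesis using that(5) by blast
    next
      assume r: "\<not> (\<exists>y<k. y \<notin> U)" "\<exists>y>k. y \<notin> U"
      then obtain b where "k < b" "b \<notin> U" "{k..<b} \<subseteq> U"
        using right True by blast
      moreover from this have "{..<b} \<subseteq> U" using r by (auto simp: subset_iff) (meson not_le)
      ultimately show thesis using that(4) by blast
    next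
      assume r: "\<not> (\<exists>y<k. y \<notin> U)" "\<not> (\<exists>y>k. y \<notin> U)"
      have "U = UNIV" using r True by (auto simp: set_eq_iff) (metis linorder_less_linear)
      then show thesis using that(2) by blast
    qed
  qed (use that(1) in blast)
  then show ?thesis
  proof cases
    case 1
    then show ?thesis by (rule call_le)
  next
    case 2
    \<comment> \<open>Here no strike lies outside \<open>U\<close>. Instead, \<open>after\<close>
      leaves no mass of \<open>\<mu>\<close> beyond \<open>t\<close>, so \<open>\<pi>\<close>
      contributes the whole integral against \<open>\<nu>\<close>, which bounds that of
      \<open>\<pi>lc\<close>.\<close>
    have "AE z in \<pi>lc. \<not> t < fst z" using after 2 by simp
    then have "AE x in distr \<pi>lc borel fst. \<not> t < x" by (subst AE_distr_iff) auto
    moreover have "distr \<pi>lc borel fst = distr \<pi> borel fst"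
      using \<pi>lc \<pi> by (simp add: martingale_plans_def)
    ultimately have "AE x in distr \<pi> borel fst. \<not> t < x" by (simp only:)
    then have "AE z in \<pi>. \<not> t < fst z" by (subst (asm) AE_distr_iff) auto
    then have "(\<integral>z. indicator {..t} (fst z) * max 0 (snd z - k) \<partial>\<pi>) = (\<integral>z. max 0 (snd z - k) \<partial>\<pi>)"
      by (intro integral_cong_AE) (auto simp: indicator_def elim!: eventually_mono)
    also have "\<dots> = (\<integral>y. max 0 (y - k) \<partial>\<nu>)" by (rule integrable_martingale_plans(4)[OF \<pi>]) simp
    also have "\<dots> = (\<integral>z. max 0 (snd z - k) \<partial>\<pi>lc)"
      by (rule integrable_martingale_plans(4)[OF \<pi>lc, symmetric]) simp
    also have "\<dots> \<ge> (\<integral>z. indicator {..t} (fst z) * max 0 (snd z - k) \<partial>\<pi>lc)"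
      by (intro integral_mono_AE' integrable_martingale_plans(2)[OF \<pi>lc] AE_I2) (auto simp: indicator_def)
    finally show ?thesis by (simp add: snd_marginal_upto_integral S)
  next
    case (3 a b)
    \<comment> \<open>\<open>s\<close> is the slope of the chord from \<open>(a, 0)\<close> to
      \<open>(b, b - k)\<close>. Weights \<open>s\<close> at strike \<open>a\<close> and
      \<open>1 - s\<close> at strike \<open>b\<close> give a function with slope \<open>s\<close>
      between the strikes, 0 before and 1 after them.\<close>
    define s where "s = (b - k) / (b - a)"
    have s: "0 \<le> s" "s \<le> 1" "s * (b - a) = b - k" using 3 by (auto simp: s_def)
    show ?thesis
    proof (rule dominate[of s "1 - s" a b _ 0])
      fix y
      have "s * (y - a) \<ge> 0" if "a \<le> y" using s that by (intro mult_nonneg_nonneg) auto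
      moreover have "(1 - s) * (b - y) \<ge> 0" if "y \<le> b" using s that by (intro mult_nonneg_nonneg) auto
      moreover have "s * (y - a) = y - k + (1 - s) * (b - y)" using s(3) by (simp add: algebra_simps)
      ultimately show "max 0 (y - k) \<le> 0 + s * max 0 (y - a) + (1 - s) * max 0 (y - b)"
        using s 3 by (auto simp: max_def algebra_simps)
      assume "y \<notin> U"
      then have "y \<le> a \<or> b \<le> y" using 3 by (meson greaterThanLessThan_iff not_le subsetD)
      then show "0 + s * max 0 (y - a) + (1 - s) * max 0 (y - b) = max 0 (y - k)"
        using s(3) 3 by (auto simp: max_def algebra_simps)
    qed (use s 3 in auto)
  next
    case (4 b)
    show ?thesis
    \<comment> \<open>With no finite left end the constant \<open>b - k\<close> replaces the call up
      to \<open>b\<close>; the strike of weight 0 is a placeholder.\<close>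
    proof (rule dominate[of 0 1 b b _ "b - k"])
      fix y assume "y \<notin> U"
      then have "b \<le> y" using 4 by (meson lessThan_iff not_le subsetD)
      then show "b - k + 0 * max 0 (y - b) + 1 * max 0 (y - b) = max 0 (y - k)" using 4 by auto
    qed (use 4 in auto)
  next
    case (5 a)
    show ?thesis
    \<comment> \<open>With no finite right end the strike moves down to \<open>a\<close>: this
      raises the call, and both calls vanish up to \<open>a\<close>. The strike of weight 0 is again
      a placeholder.\<close>
    proof (rule dominate[of 1 0 a a _ 0])
      fix y assume "y \<notin> U"
      then have "y \<le> a" using 5 by (meson greaterThan_iff not_le subsetD)
      then show "0 + 1 * max 0 (y - a) + 0 * max 0 (y - a) = max 0 (y - k)" using 5 by auto
    qed (use 5 in auto)
  qed
qed

theorem theorem1p8: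
  fixes \<mu> \<nu> :: "real measure" and \<pi>lc :: "(real \<times> real) measure" and t :: real
  assumes "prob_space \<mu>" and "prob_space \<nu>"
    and "\<mu> \<preceq>\<^sub>C \<nu>"
    and "left_curtain_coupling \<mu> \<nu> \<pi>lc"
  shows "\<forall>\<pi>\<in>\<Pi>\<^sub>M \<mu> \<nu>. snd_marginal_upto \<pi>lc t \<preceq>\<^sub>C snd_marginal_upto \<pi> t"
proof
  fix \<pi> assume \<pi>: "\<pi> \<in> \<Pi>\<^sub>M \<mu> \<nu>"
  have \<pi>lc: "\<pi>lc \<in> \<Pi>\<^sub>M \<mu> \<nu>" and "left_monotone \<pi>lc"
    using assms(4) by (auto simp: left_curtain_coupling_def)
  then obtain \<Gamma> where \<Gamma>: "\<Gamma> \<in> sets borel" "emeasure \<pi>lc \<Gamma> = 1"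
    and mono: "\<forall>x ym yp x' y'. (x, ym) \<in> \<Gamma> \<and> (x, yp) \<in> \<Gamma> \<and> (x', y') \<in> \<Gamma> \<longrightarrow>
        \<not> (x < x' \<and> ym < y' \<and> y' < yp)"
    unfolding left_monotone_def by blast
  have m: "finite_first_moment \<mu>" "finite_first_moment \<nu>"
    using assms(3) by (auto simp: convex_order_def)
  have S: "sets \<pi>lc = sets borel" using martingale_plans_sets[OF \<pi>lc] by simp
  \<comment> \<open>\<open>\<pi>lc\<close> inherits total mass 1 from its first marginal
    \<open>\<mu>\<close>; this turns \<open>emeasure \<pi>lc \<Gamma> = 1\<close> into an almost
    sure statement.\<close>
  have "fst \<in> \<pi>lc \<rightarrow>\<^sub>M borel" by (simp add: measurable_cong_sets[OF S refl])
  moreover have "prob_space (distr \<pi>lc borel fst)"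
    using assms(1) \<pi>lc by (simp add: martingale_plans_def)
  ultimately interpret lc: prob_space \<pi>lc by (rule prob_space_distrD)
  have "AE z in \<pi>lc. z \<in> \<Gamma>"
    using \<Gamma> S by (intro lc.AE_in_set_eq_1[THEN iffD2]) (auto simp: measure_def)
  note calls = calls_upto_ordered[OF \<pi>lc \<pi> m \<Gamma>(1) this mono]
  show "snd_marginal_upto \<pi>lc t \<preceq>\<^sub>C snd_marginal_upto \<pi> t"
    using snd_marginal_upto_martingale_plan[OF \<pi>lc m, of t] snd_marginal_upto_martingale_plan[OF \<pi> m, of t]
    by (intro convex_order_if_calls calls) auto
qed

end
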